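(* Let $a\in\mathbb{R}$, $b\in\mathbb{R}\setminus\{0\}$, $\sigma\in\{+1,-1\}$, and consider the three-stage stochastic Runge-Kutta (SRK) scheme ($s=3$) with coefficients $$A=\begin{pmatrix} a_1 & 0 & 0 \\ a_1-a_2 & a_2 & 0 \\ 1-a_3 & 0 & a_3 \end{pmatrix},\quad B^{(1)}=\begin{pmatrix} 0 & 0 & 0 \\ b & 0 & 0 \\ 1-\frac1{2b} & \frac1{2b} & 0 \end{pmatrix},\quad B^{(2)}=0,\quad B^{(3)}=\begin{pmatrix} 0 & 0 & 0 \\ -\sigma b & 0 & 0 \\ -\frac{\sigma}{2b} & \frac{\sigma}{2b} & 0 \end{pmatrix}$$ in the case $a_1=a_2=a$ and $a_3=1$. This (strong order 1.0) scheme is $A$-stable for the linear test equation $\mathrm{d}X_t=\lambda X_t\,\mathrm{d}t+\mu X_t\,\mathrm{d}W_t$ ($\lambda,\mu\in\mathbb{C}$), i.e. $\mathcal{D}_{SDE}\subseteq\mathcal{D}_{SRK}$, if and only if $a\ge\frac14$ (with $b\in\mathbb{R}\setminus\{0\}$ arbitrary).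
   Context: A stiffly accurate $s$-stage SRK method with real $s\times s$ coefficient matrices $A,B^{(1)},B^{(2)},B^{(3)}$, applied with constant step size $h>0$ to the scalar test equation $\mathrm{d}X_t=\lambda X_t\,\mathrm{d}t+\mu X_t\,\mathrm{d}W_t$ ($W$ a real Wiener process, Itô sense, $\lambda,\mu\in\mathbb{C}$), computes stages $H=(H_1,\dots,H_s)^T$ from $$H=e\,y_n+\lambda hAH+\mu\Big(I_{(1),n}B^{(1)}+\tfrac{I_{(1,1),n}}{\sqrt h}B^{(2)}+\sqrt h\,B^{(3)}\Big)H,\qquad y_{n+1}=H_s,$$ where $e=(1,\dots,1)^T\in\mathbb{R}^s$, $I_{(1),n}=\sqrt h\,\xi_n$ with $\xi_n\sim N(0,1)$ independent, and $I_{(1,1),n}=\frac12(I_{(1),n}^2-h)$. With $\hat h=\lambda h$ and $k=\mu\sqrt h$ this gives $y_{n+1}=R_n(\hat h,k)\,y_n$, with stability function $$R_n(\hat h,k)=\varepsilon_s^T\Big(I_s-\hat hA-k\big(\xi_nB^{(1)}+\tfrac12(\xi_n^2-1)B^{(2)}+B^{(3)}\big)\Big)^{-1}e,\qquad \varepsilon_s=(0,\dots,0,1)^T\in\mathbb{R}^s,$$ $I_s$ the identity matrix, defined wherever the inverse exists. Put $\hat R(\hat h,k)=\mathrm{E}(|R_n(\hat h,k)|^2)$. Domains of mean-square stability: $\mathcal{D}_{SDE}=\{(\lambda,\mu)\in\mathbb{C}^2: 2\Re(\lambda)+|\mu|^2<0\}$ and $\mathcal{D}_{SRK}=\{(\hat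 h,k)\in\mathbb{C}^2:\hat R(\hat h,k)<1\}$. The method is called $A$-stable if $\mathcal{D}_{SDE}\subseteq\mathcal{D}_{SRK}$, i.e. if $\hat R(\hat h,k)<1$ for all $(\hat h,k)\in\mathbb{C}^2$ with $2\Re(\hat h)+|k|^2<0$. *)

theory Defs
  imports "HOL-Analysis.Analysis" "HOL-Probability.Probability"
begin

definition cscale :: "complex \<Rightarrow> real^'n^'m \<Rightarrow> complex^'n^'m" where
  "cscale c M = (\<chi> i j. c * complex_of_real (M $ i $ j))"

(* For the test equation dX = lam X dt + mu X dW and step size h, the stage equations are
   srk_matrix A B1 B2 B3 (lam * h) (mu * sqrt h) xi *v H = y_n e,
   because I_(1) = sqrt h xi and I_(1,1) / sqrt h = sqrt h (xi^2 - 1) / 2.  The arguments h and k below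
   are lam * h and mu * sqrt h. *)
definition srk_matrix ::
  "real^'s^'s \<Rightarrow> real^'s^'s \<Rightarrow> real^'s^'s \<Rightarrow> real^'s^'s \<Rightarrow>
   complex \<Rightarrow> complex \<Rightarrow> real \<Rightarrow> complex^'s^'s" where
  "srk_matrix A B1 B2 B3 h k \<xi> =
     mat 1 - cscale h A - cscale k (\<xi> *\<^sub>R B1 + ((\<xi>\<^sup>2 - 1) / 2) *\<^sub>R B2 + B3)"

(* Stages are indexed by a finite type 's; l is the last stage, so selecting component l is
   multiplication by the transpose of epsilon_s.  It is passed explicitly because the order on a
   numeral type such as 3 does not agree with the numbering 1, 2, 3 used by vector (there 3 = 0).
   The value is meaningful only where srk_matrix is invertible. *)
definition srk_R ::
  "'s::finite \<Rightarrow> real^'s^'s \<Rightarrow> real^'s^'s \<Rightarrow> real^'s^'s \<Rightarrow> real^'s^'s \<Rightarrow>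
   complex \<Rightarrow> complex \<Rightarrow> real \<Rightarrow> complex" where
  "srk_R l A B1 B2 B3 h k \<xi> = (matrix_inv (srk_matrix A B1 B2 B3 h k \<xi>) *v vec 1) $ l"

definition std_normal :: "real measure" where
  "std_normal = density lborel (\<lambda>x. ennreal (std_normal_density x))"

definition srk_R_hat ::
  "'s::finite \<Rightarrow> real^'s^'s \<Rightarrow> real^'s^'s \<Rightarrow> real^'s^'s \<Rightarrow> real^'s^'s \<Rightarrow>
   complex \<Rightarrow> complex \<Rightarrow> real" where
  "srk_R_hat l A B1 B2 B3 h k = (\<integral>\<xi>. (cmod (srk_R l A B1 B2 B3 h k \<xi>))\<^sup>2 \<partial>std_normal)"

definition D_SDE :: "(complex \<times> complex) set" where
  "D_SDE = {(lam, \<mu>). 2 * Re lam + (cmod \<mu>)\<^sup>2 < 0}"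

(* The first two conditions say that R_n is defined almost surely and that its second moment is
   finite; without them the conventional values of matrix_inv (at a singular matrix) and of the
   Bochner integral (0 for a non-integrable function) could make srk_R_hat spuriously small. *)
definition D_SRK ::
  "'s::finite \<Rightarrow> real^'s^'s \<Rightarrow> real^'s^'s \<Rightarrow> real^'s^'s \<Rightarrow> real^'s^'s \<Rightarrow>
   (complex \<times> complex) set" where
  "D_SRK l A B1 B2 B3 = {(h, k).
     (AE \<xi> in std_normal. invertible (srk_matrix A B1 B2 B3 h k \<xi>)) \<and>
     integrable std_normal (\<lambda>\<xi>. (cmod (srk_R l A B1 B2 B3 h k \<xi>))\<^sup>2) \<and>
     srk_R_hat l A B1 B2 B3 h k < 1}"

definition A_stable ::
  "'s::finite \<Rightarrow> real^'s^'s \<Rightarrow> real^'s^'s \<Rightarrow> real^'s^'s \<Rightarrow> real^'s^'s \<Rightarrow> bool" where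
  "A_stable l A B1 B2 B3 \<longleftrightarrow> D_SDE \<subseteq> D_SRK l A B1 B2 B3"

definition scheme_A :: "real \<Rightarrow> real \<Rightarrow> real \<Rightarrow> real^3^3" where
  "scheme_A a1 a2 a3 = vector
     [vector [a1,      0,  0],
      vector [a1 - a2, a2, 0],
      vector [1 - a3,  0,  a3]]"

definition scheme_B1 :: "real \<Rightarrow> real^3^3" where
  "scheme_B1 b = vector
     [vector [0,               0,           0],
      vector [b,               0,           0],
      vector [1 - 1 / (2 * b), 1 / (2 * b), 0]]"

definition scheme_B2 :: "real^3^3" where
  "scheme_B2 = 0"

definition scheme_B3 :: "real \<Rightarrow> real \<Rightarrow> real^3^3" where
  "scheme_B3 \<sigma> b = vector
     [vector [0,             0,           0],
      vector [- \<sigma> * b,       0,           0],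
      vector [- \<sigma> / (2 * b), \<sigma> / (2 * b), 0]]"

end

theory Submission
  imports Defs
begin

text \<open>
  Forward substitution through the triangular stage system gives, with \<open>u = 1 / (1 - a h)\<close>,
  \<open>(1 - h) R = 1 + k u \<xi> + (k u)\<^sup>2 (\<xi>\<^sup>2 - 1) / 2\<close>; the parameters \<open>b\<close> and \<open>\<sigma>\<close> cancel because
  \<open>\<sigma>\<^sup>2 = 1\<close>.  The Hermite polynomials \<open>1, \<xi>, \<xi>\<^sup>2 - 1\<close> are orthogonal with squared norms \<open>1, 1, 2\<close>, so mean-square
  stability reads \<open>1 + w + w\<^sup>2 / 2 < |1 - h|\<^sup>2\<close> with \<open>w = |k u|\<^sup>2\<close>.  On the boundary \<open>|k|\<^sup>2 = 2 x\<close>,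
  \<open>h = - x\<close> real, the difference of the two sides is \<open>(4 a - 1) x\<^sup>2\<close> up to higher order in \<open>x\<close>,
  which forces \<open>a \<ge> 1/4\<close>; conversely, increasing \<open>a\<close> or adding an imaginary part to \<open>h\<close>
  only helps, so it suffices to check a one-variable polynomial inequality at \<open>a = 1/4\<close>.
\<close>

lemma has_bochner_integral_std_normal:
  fixes f :: "real \<Rightarrow> real"
  assumes "f \<in> borel_measurable borel"
    and "has_bochner_integral lborel (\<lambda>x. std_normal_density x * f x) I"
  shows "has_bochner_integral std_normal f I"
  unfolding std_normal_def using assms
  by (intro has_bochner_integral_density) auto

lemma std_normal_has_integral_powers:
  "has_bochner_integral std_normal (\<lambda>x. 1) (1::real)"
  "has_bochner_integral std_normal (\<lambda>x. x) (0::real)"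
  "has_bochner_integral std_normal (\<lambda>x. x ^ 2) (1::real)"
  "has_bochner_integral std_normal (\<lambda>x. x ^ 3) (0::real)"
  "has_bochner_integral std_normal (\<lambda>x. x ^ 4) (3::real)"
  using std_normal_moment_even[of 0] std_normal_moment_odd[of 0]
    std_normal_moment_even[of 1] std_normal_moment_odd[of 1] std_normal_moment_even[of 2]
  by (auto intro!: has_bochner_integral_std_normal simp: fact_numeral numeral_3_eq_3)

lemma std_normal_has_integral_cmod_quadratic:
  fixes c0 c1 c2 :: complex
  shows "has_bochner_integral std_normal
    (\<lambda>x. (cmod (c0 + c1 * of_real x + c2 * of_real (x\<^sup>2 - 1)))\<^sup>2)
    ((cmod c0)\<^sup>2 + (cmod c1)\<^sup>2 + 2 * (cmod c2)\<^sup>2)"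
proof -
  \<comment> \<open>These are the cross terms of the expanded square. Against the moments 1, 0, 1,
    0, 3, \<open>p\<close> and \<open>r\<close> meet only odd powers, while \<open>q\<close> enters
    with opposite signs at \<open>1\<close> and \<open>x ^ 2\<close>, so all three drop out.\<close>
  define p q r where "p = 2 * Re (c0 * cnj c1)" and "q = 2 * Re (c0 * cnj c2)"
    and "r = 2 * Re (c1 * cnj c2)"
  let ?A = "(cmod c0)\<^sup>2" let ?B = "(cmod c1)\<^sup>2" let ?C = "(cmod c2)\<^sup>2"
  have "(cmod (c0 + c1 * of_real x + c2 * of_real (x\<^sup>2 - 1)))\<^sup>2 =
      (?A + ?C - q) * 1 + (p - r) * x + (?B + q - 2 * ?C) * x ^ 2 + r * x ^ 3 + ?C * x ^ 4" for x :: real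
    unfolding cmod_power2 p_def q_def r_def by (simp add: algebra_simps) algebra
  moreover have "has_bochner_integral std_normal
    (\<lambda>x. (?A + ?C - q) * 1 + (p - r) * x + (?B + q - 2 * ?C) * x ^ 2 + r * x ^ 3 + ?C * x ^ 4)
    ((?A + ?C - q) * 1 + (p - r) * 0 + (?B + q - 2 * ?C) * 1 + r * 0 + ?C * 3)"
    by (intro has_bochner_integral_add has_bochner_integral_mult_right std_normal_has_integral_powers)
  moreover have "(?A + ?C - q) * 1 + (p - r) * 0 + (?B + q - 2 * ?C) * 1 + r * 0 + ?C * 3 = ?A + ?B + 2 * ?C"
    by simp
  ultimately show ?thesis by (simp only:)
qed

text \<open>The stage matrix is lower triangular and the \<open>B\<close> matrices vanish on the
  diagonal, so neither \<open>k\<close> nor \<open>\<xi>\<close> reaches the determinant.\<close>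

lemma det_srk_matrix:
  fixes a b \<sigma> \<xi> :: real and h k :: complex
  shows "det (srk_matrix (scheme_A a a 1) (scheme_B1 b) scheme_B2 (scheme_B3 \<sigma> b) h k \<xi>) =
     (1 - a * h)\<^sup>2 * (1 - h)"
  unfolding srk_matrix_def cscale_def scheme_A_def scheme_B1_def scheme_B2_def scheme_B3_def
  by (simp add: det_3 mat_def power2_eq_square algebra_simps)

lemma srk_R_eq:
  fixes a b \<sigma> \<xi> :: real and h k :: complex
  assumes "b \<noteq> 0" "\<sigma> \<in> {1, -1}" "1 - a * h \<noteq> 0" "1 - h \<noteq> 0"
  shows "srk_R (3::3) (scheme_A a a 1) (scheme_B1 b) scheme_B2 (scheme_B3 \<sigma> b) h k \<xi> =
     1 / (1 - h) + k / (1 - a * h) / (1 - h) * of_real \<xi>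
       + (k / (1 - a * h))\<^sup>2 / (2 * (1 - h)) * of_real (\<xi>\<^sup>2 - 1)"
proof -
  let ?M = "srk_matrix (scheme_A a a 1) (scheme_B1 b) scheme_B2 (scheme_B3 \<sigma> b) h k \<xi>"
  define H where "H = matrix_inv ?M *v vec 1"
  have "invertible ?M"
    using assms by (simp add: invertible_det_nz det_srk_matrix)
  then have "?M ** matrix_inv ?M = mat 1"
    unfolding invertible_def matrix_inv_def by (rule someI2_ex) simp
  then have "?M *v H = vec 1"
    by (simp add: H_def matrix_vector_mul_assoc)
  then have eqs: "(?M *v H) $ 1 = 1" "(?M *v H) $ 2 = 1" "(?M *v H) $ 3 = 1"
    by simp_all
  note D = srk_matrix_def cscale_def scheme_A_def scheme_B1_def scheme_B2_def scheme_B3_def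
  define u where "u = 1 / (1 - a * h)"
  have u: "(1 - a * h) * u = 1" using assms by (simp add: u_def)
  have H1: "(1 - a * h) * H $ 1 = 1"
    using eqs(1) by (simp add: D matrix_vector_mult_def sum_3 mat_def algebra_simps)
  have H2: "(1 - a * h) * H $ 2 - k * b * (\<xi> - \<sigma>) * H $ 1 = 1"
    using eqs(2) by (simp add: D matrix_vector_mult_def sum_3 mat_def algebra_simps)
  have H3: "(1 - h) * H $ 3 - k * (\<xi> * (1 - 1 / (2 * b)) - \<sigma> / (2 * b)) * H $ 1
      - k * ((\<xi> + \<sigma>) / (2 * b)) * H $ 2 = 1"
    using eqs(3) by (simp add: D matrix_vector_mult_def sum_3 mat_def algebra_simps add_divide_distrib)
  have h1: "H $ 1 = u" using H1 assms by (simp add: u_def field_simps)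
  have h2: "H $ 2 = u + k * b * (\<xi> - \<sigma>) * u\<^sup>2"
    using H2 h1 u by algebra
  have s: "(of_real \<sigma>)\<^sup>2 = (1::complex)" using assms(2) by auto
  have "(1 - h) * H $ 3 = 1 + k * (\<xi> * (1 - 1 / (2 * b)) - \<sigma> / (2 * b)) * u
      + k * ((\<xi> + \<sigma>) / (2 * b)) * (u + k * b * (\<xi> - \<sigma>) * u\<^sup>2)"
    using H3 h1 h2 by (simp add: algebra_simps)
  \<comment> \<open>The terms linear in \<open>k\<close> add up to \<open>k * u * \<xi>\<close>. In
    the quadratic term \<open>b\<close> cancels and
    \<open>(\<xi> + \<sigma>) * (\<xi> - \<sigma>)\<close> is a difference of squares.\<close>
  also have "\<dots> = 1 + k * u * \<xi> + (k * u)\<^sup>2 * (\<xi>\<^sup>2 - of_real \<sigma> ^ 2) / 2"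
    using assms(1) by (simp add: field_simps power2_eq_square)
  finally have "(1 - h) * H $ 3 = 1 + k * u * \<xi> + (k * u)\<^sup>2 * (\<xi>\<^sup>2 - 1) / 2"
    by (simp add: s)
  then have "H $ 3 = (1 + k * u * \<xi> + (k * u)\<^sup>2 * (\<xi>\<^sup>2 - 1) / 2) / (1 - h)"
    using assms(4) by (simp add: field_simps)
  then show ?thesis
    unfolding srk_R_def H_def[symmetric] u_def
    by (simp add: add_divide_distrib)
qed

text \<open>Invertibility holds for every \<open>\<xi>\<close> and the stability function is a
  polynomial in \<open>\<xi>\<close>, so the two side conditions in \<open>D_SRK\<close> are
  automatic and only the bound on the second moment remains.\<close>

lemma D_SRK_iff:
  fixes a b \<sigma> :: real and h k :: complex
  assumes "b \<noteq> 0" "\<sigma> \<in> {1, -1}" "1 - a * h \<noteq> 0" "1 - h \<noteq> 0"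
  defines "w \<equiv> (cmod k)\<^sup>2 / (cmod (1 - a * h))\<^sup>2"
  shows "(h, k) \<in> D_SRK (3::3) (scheme_A a a 1) (scheme_B1 b) scheme_B2 (scheme_B3 \<sigma> b) \<longleftrightarrow>
     1 + w + w\<^sup>2 / 2 < (cmod (1 - h))\<^sup>2"
proof -
  let ?R = "srk_R (3::3) (scheme_A a a 1) (scheme_B1 b) scheme_B2 (scheme_B3 \<sigma> b) h k"
  have inv: "invertible (srk_matrix (scheme_A a a 1) (scheme_B1 b) scheme_B2 (scheme_B3 \<sigma> b) h k \<xi>)" for \<xi>
    using assms by (simp add: invertible_det_nz det_srk_matrix)
  have int: "has_bochner_integral std_normal (\<lambda>\<xi>. (cmod (?R \<xi>))\<^sup>2)
    ((cmod (1 / (1 - h)))\<^sup>2 + (cmod (k / (1 - a * h) / (1 - h)))\<^sup>2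
      + 2 * (cmod ((k / (1 - a * h))\<^sup>2 / (2 * (1 - h))))\<^sup>2)"
    unfolding srk_R_eq[OF assms(1-4)] by (rule std_normal_has_integral_cmod_quadratic)
  have "(cmod (1 / q))\<^sup>2 + (cmod (k / p / q))\<^sup>2 + 2 * (cmod ((k / p)\<^sup>2 / (2 * q)))\<^sup>2
      = (1 + v + v\<^sup>2 / 2) / (cmod q)\<^sup>2" if "v = (cmod k)\<^sup>2 / (cmod p)\<^sup>2" for p q v
    unfolding that by (simp add: norm_divide norm_mult norm_power power_divide power_mult_distrib
        add_divide_distrib)
  from this[of w "1 - a * h" "1 - h"]
  have "has_bochner_integral std_normal (\<lambda>\<xi>. (cmod (?R \<xi>))\<^sup>2)
    ((1 + w + w\<^sup>2 / 2) / (cmod (1 - h))\<^sup>2)"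
    using int by (simp only: w_def)
  then show ?thesis
    using inv assms(4)
    by (auto simp: D_SRK_def srk_R_hat_def has_bochner_integral_iff divide_less_eq)
qed

text \<open>Here \<open>x\<close>, \<open>y\<close>, \<open>K\<close> stand for
  \<open>- Re h\<close>, \<open>Im h\<close> and the squared modulus of \<open>k\<close>. The left
  side grows with \<open>w\<close>, which is largest in the limit \<open>K = 2 * x\<close>,
  \<open>a = 1/4\<close>, \<open>y = 0\<close>.\<close>

lemma stability_inequality:
  fixes a x y K :: real
  assumes "a \<ge> 1/4" "x > 0" "0 \<le> K" "K < 2 * x"
  defines "w \<equiv> K / ((1 + a * x)\<^sup>2 + (a * y)\<^sup>2)"
  shows "1 + w + w\<^sup>2 / 2 < (1 + x)\<^sup>2 + y\<^sup>2"
proof -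
  \<comment> \<open>\<open>d\<close> is \<open>1 + a * x\<close> at the critical value
    \<open>a = 1/4\<close>; the scaling \<open>t\<close> clears fractions.\<close>
  define d t where "d = 1 + t" and "t = x / 4"
  have t: "t > 0" and x: "x = 4 * t" using assms by (auto simp: t_def)
  have "d \<le> 1 + a * x"
    using mult_right_mono[of "1/4" a x] assms by (simp add: d_def t_def)
  then have "d\<^sup>2 \<le> (1 + a * x)\<^sup>2 + (a * y)\<^sup>2"
    using power_mono[of d "1 + a * x" 2] t by (smt (verit) d_def zero_le_power2)
  moreover have d: "d > 0" using t by (simp add: d_def)
  ultimately have w: "w \<le> 2 * x / d\<^sup>2" "w \<ge> 0"
    unfolding w_def using assms by (auto intro!: frac_le add_nonneg_nonneg)
  have "1 + w + w\<^sup>2 / 2 \<le> 1 + 2 * x / d\<^sup>2 + (2 * x / d\<^sup>2)\<^sup>2 / 2"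
    using w power_mono[OF w, of 2] by linarith
  also have "\<dots> = 1 + x * ((2 * d ^ 2 + 2 * x) / d ^ 4)"
    using d by (simp add: field_simps power2_eq_square power4_eq_xxxx)
  also have "\<dots> < 1 + x * (2 + x)"
  proof -
    \<comment> \<open>The constant and linear terms in \<open>t\<close> cancel, and all remaining
      coefficients are positive.\<close>
    have "(2 + x) * d ^ 4 - (2 * d ^ 2 + 2 * x) = 2 * t\<^sup>2 * (13 + 16 * t + 9 * t\<^sup>2 + 2 * t ^ 3)"
      unfolding x d_def by algebra
    also have "\<dots> > 0" using t by (intro mult_pos_pos add_pos_pos) auto
    finally show ?thesis using d assms(2) by (simp add: divide_less_eq)
  qed
  also have "\<dots> \<le> (1 + x)\<^sup>2 + y\<^sup>2" by (simp add: power2_eq_square algebra_simps)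
  finally show ?thesis .
qed

lemma instability_inequality:
  fixes a :: real
  assumes "a < 1/4"
  obtains x K where "x > 0" "1 + a * x > 0" "0 \<le> K" "K < 2 * x"
    "1 + K / (1 + a * x)\<^sup>2 + (K / (1 + a * x)\<^sup>2)\<^sup>2 / 2 > (1 + x)\<^sup>2"
proof -
  \<comment> \<open>Times \<open>x\<^sup>2\<close>, this polynomial bounds the excess at
    \<open>K = 2 * x\<close> from below; it tends to \<open>1 - 4 * a > 0\<close> as
    \<open>x\<close> tends to 0.\<close>
  have "eventually (\<lambda>x. 1 - 4 * a - (2 * a\<^sup>2 + 8 * a) * x - 4 * a\<^sup>2 * x\<^sup>2 > 0) (at_right 0)"
    by (rule order_tendstoD) (use assms in \<open>auto intro!: tendsto_eq_intros\<close>)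
  moreover have "eventually (\<lambda>x. 1 + a * x > 0) (at_right 0)"
    by (rule order_tendstoD) (auto intro!: tendsto_eq_intros)
  moreover have "eventually (\<lambda>x::real. x > 0) (at_right 0)"
    by (rule eventually_at_right_less)
  ultimately have "eventually (\<lambda>x. x > 0 \<and> 1 + a * x > 0 \<and>
      1 - 4 * a - (2 * a\<^sup>2 + 8 * a) * x - 4 * a\<^sup>2 * x\<^sup>2 > 0) (at_right 0)"
    by eventually_elim auto
  then obtain x where x: "x > 0" "1 + a * x > 0"
    "1 - 4 * a - (2 * a\<^sup>2 + 8 * a) * x - 4 * a\<^sup>2 * x\<^sup>2 > 0"
    using eventually_happens'[OF trivial_limit_at_right_real] by blast
  txt \<open>The inequality is strict at the boundary value \<open>K = 2 x\<close>, hence persists slightly below it.\<close>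
  define v where "v = 1 / (1 + a * x)\<^sup>2"
  define f where "f K = 1 + K * v + (K * v)\<^sup>2 / 2" for K
  have v0: "v > 0" using x by (simp add: v_def)
  \<comment> \<open>Both \<open>v\<close> and \<open>v\<^sup>2\<close> are bounded below by tangent
    lines at 1, which turns the rational inequality into a polynomial one.\<close>
  have "v * (1 + a * x)\<^sup>2 = 1" using x by (simp add: v_def)
  then have "v * ((1 + a * x)\<^sup>2 - 1)\<^sup>2 = v + (1 + a * x)\<^sup>2 - 2" by algebra
  moreover have "0 \<le> v * ((1 + a * x)\<^sup>2 - 1)\<^sup>2" using v0 by simp
  ultimately have v: "v \<ge> 2 - (1 + a * x)\<^sup>2" by linarith
  have v2: "v\<^sup>2 \<ge> 2 * v - 1"
    using zero_le_power2[of "v - 1"] by (simp add: power2_diff)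
  have "(1 + x)\<^sup>2 < 1 + x * (2 * (2 - (1 + a * x)\<^sup>2) + 2 * x * (2 * (2 - (1 + a * x)\<^sup>2) - 1))"
  proof -
    have "1 + x * (2 * (2 - (1 + a * x)\<^sup>2) + 2 * x * (2 * (2 - (1 + a * x)\<^sup>2) - 1)) - (1 + x)\<^sup>2
      = x\<^sup>2 * (1 - 4 * a - (2 * a\<^sup>2 + 8 * a) * x - 4 * a\<^sup>2 * x\<^sup>2)" by algebra
    also have "\<dots> > 0" using x by simp
    finally show ?thesis by simp
  qed
  also have "\<dots> \<le> 1 + x * (2 * v + 2 * x * v\<^sup>2)"
    using x v v2 by (intro add_left_mono mult_left_mono add_mono) auto
  also have "\<dots> = f (2 * x)" by (simp add: f_def power2_eq_square algebra_simps)
  finally have "(1 + x)\<^sup>2 < f (2 * x)" .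
  moreover have "(f \<longlongrightarrow> f (2 * x)) (at_left (2 * x))"
    unfolding f_def by (auto intro!: tendsto_eq_intros)
  ultimately have "eventually (\<lambda>K. (1 + x)\<^sup>2 < f K) (at_left (2 * x))"
    by (rule order_tendstoD(1)[rotated])
  moreover have "eventually (\<lambda>K. K \<in> {0<..<2 * x}) (at_left (2 * x))"
    using x by (intro eventually_at_left_real) simp
  ultimately have "eventually (\<lambda>K. (1 + x)\<^sup>2 < f K \<and> K \<in> {0<..<2 * x}) (at_left (2 * x))"
    by eventually_elim auto
  then obtain K where "(1 + x)\<^sup>2 < f K" "K \<in> {0<..<2 * x}"
    using eventually_happens'[OF trivial_limit_at_left_real] by blast
  then show thesis using x by (intro that[of x K]) (auto simp: f_def v_def)
qed

lemma cmod_one_minus_mult_power2: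
  "(cmod (1 - of_real a * h))\<^sup>2 = (1 + a * (- Re h))\<^sup>2 + (a * Im h)\<^sup>2"
  by (simp add: cmod_power2)

theorem lemma5p5:
  fixes a b \<sigma> :: real
  assumes "b \<noteq> 0"
    and "\<sigma> \<in> {1, -1}"
  shows "A_stable (3::3) (scheme_A a a 1) (scheme_B1 b) scheme_B2 (scheme_B3 \<sigma> b)
           \<longleftrightarrow> a \<ge> 1/4"
proof
  assume stable: "A_stable (3::3) (scheme_A a a 1) (scheme_B1 b) scheme_B2 (scheme_B3 \<sigma> b)"
  show "a \<ge> 1/4"
  proof (rule ccontr)
    assume "\<not> a \<ge> 1/4"
    then obtain x K where xK: "x > 0" "1 + a * x > 0" "0 \<le> K" "K < 2 * x"
      "1 + K / (1 + a * x)\<^sup>2 + (K / (1 + a * x)\<^sup>2)\<^sup>2 / 2 > (1 + x)\<^sup>2"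
      using instability_inequality[of a] by (auto simp: not_le)
    \<comment> \<open>A real pair suffices. Since \<open>a\<close> may be negative,
      \<open>1 + a * x > 0\<close> is what keeps the stage matrix invertible.\<close>
    define h k where "h = complex_of_real (- x)" and "k = complex_of_real (sqrt K)"
    have ah: "1 - a * h = of_real (1 + a * x)" and h: "1 - h = of_real (1 + x)"
      by (simp_all add: h_def)
    have "(h, k) \<in> D_SDE" using xK by (simp add: D_SDE_def h_def k_def)
    then have "(h, k) \<in> D_SRK (3::3) (scheme_A a a 1) (scheme_B1 b) scheme_B2 (scheme_B3 \<sigma> b)"
      using stable by (auto simp: A_stable_def)
    moreover have "1 - a * h \<noteq> 0" "1 - h \<noteq> 0"
      unfolding ah h of_real_eq_0_iff using xK by simp_all
    ultimately show False
      using xK by (simp add: D_SRK_iff[OF assms] ah h k_def norm_of_real del: of_real_add of_real_mult)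
  qed
next
  assume a: "a \<ge> 1/4"
  show "A_stable (3::3) (scheme_A a a 1) (scheme_B1 b) scheme_B2 (scheme_B3 \<sigma> b)"
    unfolding A_stable_def
  proof safe
    fix h k assume "(h, k) \<in> D_SDE"
    then have K: "(cmod k)\<^sup>2 < 2 * (- Re h)" by (simp add: D_SDE_def)
    then have x: "- Re h > 0" using zero_le_power2[of "cmod k"] by linarith
    \<comment> \<open>For \<open>Re h < 0\<close> both diagonal factors have positive real part, so
      the stage matrix is never singular.\<close>
    have "1 + a * (- Re h) > 0" using a x by (intro add_pos_nonneg mult_nonneg_nonneg) auto
    then have ah: "1 - a * h \<noteq> 0" by (auto simp: complex_eq_iff)
    have h: "1 - h \<noteq> 0" using x by (auto simp: complex_eq_iff)
    have "(cmod (1 - h))\<^sup>2 = (1 + (- Re h))\<^sup>2 + (Im h)\<^sup>2" by (simp add: cmod_power2)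
    then show "(h, k) \<in> D_SRK (3::3) (scheme_A a a 1) (scheme_B1 b) scheme_B2 (scheme_B3 \<sigma> b)"
      unfolding D_SRK_iff[OF assms ah h] cmod_one_minus_mult_power2
      using stability_inequality[OF a x _ K, of "Im h"] by simp
  qed
qed

end
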